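(* Let $t\ge 2$ be an integer, let $M$ be a $t$-cyclic matroid with $n=|E(M)|\ge 2(t+2)-2$, and let $\sigma=(e_1,e_2,\ldots,e_n)$ be a $t$-cyclic ordering of $M$. Let $M'$ be the truncation of $M$, and let $N$ be the Higgs lift of $M'$. Then $N$ is a $(t+2)$-cyclic matroid, and $\sigma$ is a $(t+2)$-cyclic ordering of $N$.
   Context: Notation: $[n]=\{1,\ldots,n\}$. For a cyclic ordering $(e_1,\ldots,e_n)$ of $E(M)$, subscripts are interpreted modulo $n$. $t$-cyclic matroids: Let $M$ be a matroid with $n=|E(M)|$ and let $t$ be a positive integer with $n\ge t+1$. $M$ is $t$-cyclic if there is a cyclic ordering $\sigma=(e_1,\ldots,e_n)$ of $E(M)$ such that, for all odd $i\in[n]$, either (i) $\{e_i,\ldots,e_{i+t-1}\}$ is a $t$-element circuit and $\{e_{i+1},\ldots,e_{i+t}\}$ is a $t$-element cocircuit, or (ii) $\{e_i,\ldots,e_{i+t-1}\}$ is both a $t$-element circuit and a $t$-element cocircuit. Such a $\sigma$ is a $t$-cyclic ordering of $M$. Truncation: the truncation of $M$ is the matroid on $E(M)$ obtained by freely adding an element $f$ to $M$ (without increasing rank) and then contracting $f$. Higgs lift: the Higgs lift of $M'$ is the matroid on $E(M')$ obtained by freely coextending $M'$ by an element $g$ to get a matroid $M'_1$ (that is, $(M'_1)^*$ is the free extension of $(M')^*$ by $g$) and then deleting $g$ from $M'_1$; equivalently, it is the dual of the truncation of $(M')^*$. *)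

theory Defs
  imports Main
begin

record 'a set_system =
  ground :: "'a set"
  indeps :: "'a set set"

definition matroid :: "'a set_system \<Rightarrow> bool" where
  "matroid M \<longleftrightarrow>
     finite (ground M) \<and>
     (\<forall>I\<in>indeps M. I \<subseteq> ground M) \<and>
     {} \<in> indeps M \<and>
     (\<forall>I\<in>indeps M. \<forall>J. J \<subseteq> I \<longrightarrow> J \<in> indeps M) \<and>
     (\<forall>I\<in>indeps M. \<forall>J\<in>indeps M. card I < card J \<longrightarrow> (\<exists>x\<in>J - I. insert x I \<in> indeps M))"

definition basis :: "'a set_system \<Rightarrow> 'a set \<Rightarrow> bool" where
  "basis M B \<longleftrightarrow> B \<in> indeps M \<and> (\<forall>I\<in>indeps M. B \<subseteq> I \<longrightarrow> I = B)"

definition rank :: "'a set_system \<Rightarrow> nat" where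
  "rank M = Max (card ` indeps M)"

definition circuit :: "'a set_system \<Rightarrow> 'a set \<Rightarrow> bool" where
  "circuit M C \<longleftrightarrow> C \<subseteq> ground M \<and> C \<notin> indeps M \<and> (\<forall>D. D \<subset> C \<longrightarrow> D \<in> indeps M)"

definition dual :: "'a set_system \<Rightarrow> 'a set_system" where
  "dual M = \<lparr>ground = ground M, indeps = {X. \<exists>B. basis M B \<and> X \<subseteq> ground M - B}\<rparr>"

definition cocircuit :: "'a set_system \<Rightarrow> 'a set \<Rightarrow> bool" where
  "cocircuit M C \<longleftrightarrow> circuit (dual M) C"

definition delete :: "'a set_system \<Rightarrow> 'a set \<Rightarrow> 'a set_system" where
  "delete M T = \<lparr>ground = ground M - T, indeps = {I \<in> indeps M. I \<inter> T = {}}\<rparr>"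

definition contract :: "'a set_system \<Rightarrow> 'a set \<Rightarrow> 'a set_system" where
  "contract M T = dual (delete (dual M) T)"

text \<open>
  The free extension (principal extension along the whole ground set) by a new element \<open>f\<close>,
  which must lie outside the ground set: \<open>f\<close> may be added to exactly those independent sets
  that do not span, so the rank does not increase and every circuit through \<open>f\<close> is spanning.
\<close>

definition free_extension :: "'a set_system \<Rightarrow> 'a \<Rightarrow> 'a set_system" where
  "free_extension M f =
     \<lparr>ground = insert f (ground M),
      indeps = indeps M \<union> {insert f I | I. I \<in> indeps M \<and> card I < rank M}\<rparr>"

definition free_coextension :: "'a set_system \<Rightarrow> 'a \<Rightarrow> 'a set_system" where
  "free_coextension M g = dual (free_extension (dual M) g)"

definition relabel :: "('a \<Rightarrow> 'b) \<Rightarrow> 'a set_system \<Rightarrow> 'b set_system" where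
  "relabel h M = \<lparr>ground = h ` ground M, indeps = (\<lambda>I. h ` I) ` indeps M\<rparr>"

text \<open>
  The ground set may be all of \<^typ>\<open>'a\<close>, so the auxiliary element is taken to be
  \<^const>\<open>None\<close> in \<^typ>\<open>'a option\<close>; once it has been removed again, the elements
  \<open>Some x\<close> are renamed back to \<open>x\<close>.
\<close>

definition truncation :: "'a set_system \<Rightarrow> 'a set_system" where
  "truncation M = relabel the (contract (free_extension (relabel Some M) None) {None})"

definition higgs_lift :: "'a set_system \<Rightarrow> 'a set_system" where
  "higgs_lift M = relabel the (delete (free_coextension (relabel Some M) None) {None})"

text \<open>
  A cyclic ordering \<open>(e\<^sub>1, \<dots>, e\<^sub>n)\<close> is a list \<open>\<sigma>\<close>. Subscripts start at 1 and are read
  modulo \<open>n\<close>; \<open>e\<^sub>i\<close> is only used for \<open>i \<ge> 1\<close>.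
\<close>

definition cyc_elem :: "'a list \<Rightarrow> nat \<Rightarrow> 'a" where
  "cyc_elem \<sigma> i = \<sigma> ! ((i - 1) mod length \<sigma>)"

definition cyc_interval :: "'a list \<Rightarrow> nat \<Rightarrow> nat \<Rightarrow> 'a set" where
  "cyc_interval \<sigma> i j = cyc_elem \<sigma> ` {i..j}"

definition cyclic_ordering :: "nat \<Rightarrow> 'a set_system \<Rightarrow> 'a list \<Rightarrow> bool" where
  "cyclic_ordering t M \<sigma> \<longleftrightarrow>
     distinct \<sigma> \<and> set \<sigma> = ground M \<and>
     (\<forall>i\<in>{1..card (ground M)}. odd i \<longrightarrow>
        (let A = cyc_interval \<sigma> i (i + t - 1); B = cyc_interval \<sigma> (i + 1) (i + t) in
          (circuit M A \<and> card A = t \<and> cocircuit M B \<and> card B = t) \<or>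
          (circuit M A \<and> cocircuit M A \<and> card A = t)))"

definition cyclic_matroid :: "nat \<Rightarrow> 'a set_system \<Rightarrow> bool" where
  "cyclic_matroid t M \<longleftrightarrow>
     matroid M \<and> t > 0 \<and> card (ground M) \<ge> t + 1 \<and> (\<exists>\<sigma>. cyclic_ordering t M \<sigma>)"

end

theory Submission
  imports Defs
begin

text \<open>
  Truncating \<open>M\<close> and then lifting back has an explicit description when the rank \<open>r\<close> satisfies
  \<open>0 < r < \<bar>E\<bar>\<close>: the independent sets of \<open>N\<close> are the sets \<open>X\<close> with \<open>\<bar>X\<bar> \<le> r\<close> whose nullity in \<open>M\<close>
  is at most one. The free extensions are eliminated in favour of two operations on independent
  sets: dropping the bases (\<open>trunc\<close>) and allowing nullity one (\<open>elongate\<close>). These are exchanged by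
  duality (\<open>dual_trunc\<close>) and commute (\<open>trunc_elongate\<close>), so the dual of \<open>N\<close> arises from the dual
  of \<open>M\<close> by the same construction (\<open>dual_elongate_trunc\<close>), and it suffices to find the circuits
  of \<open>N\<close>.

  Call a set of \<open>t\<close> cyclically consecutive elements the block at its first index. A circuit and a
  cocircuit of a matroid never meet in exactly one element, so a circuit block and a cocircuit
  block that overlap in one element cannot coexist. Once around the circle, this forces \<open>n\<close> to be
  even (\<open>even_length_cyclic_ordering\<close>), and then it decides between the two alternatives in the
  definition: the block at \<open>i\<close> is a circuit for every odd \<open>i\<close>, and the block at \<open>k\<close> is a cocircuit
  whenever \<open>k + t\<close> is odd (\<open>cyclic_ordering_all_blocks\<close>). The second condition has the same
  form for \<open>t\<close> and for \<open>t + 2\<close>, and the pair of conditions is symmetric under duality: from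
  the index of a block of either kind, a step of \<open>t\<close> leads to the index of a block of the other kind.

  It remains to see that the block of length \<open>t + 2\<close> at \<open>i\<close> is a circuit of \<open>N\<close>. It is the union of
  the circuits at \<open>i\<close> and \<open>i + 2\<close>, so it has nullity at least two, and every element of it lies in a
  circuit. Hence it suffices that its nullity is exactly two and that \<open>r \<ge> t + 1\<close>
  (\<open>circuit_elongate_trunc\<close>). Both follow by growing an independent set: start with the first
  \<open>t - 1\<close> elements of the block, a proper part of a circuit, and add \<open>e\<close> at \<open>i + t\<close> and then at
  \<open>i + t + 2\<close>, each time using a cocircuit which meets the enlarged set in the new element only
  (\<open>circuit_block_elongate_trunc\<close>). The last cocircuit ends at index \<open>i + 2t + 1\<close>, which is still
  less than \<open>i + n\<close> exactly because \<open>n \<ge> 2t + 2\<close>.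
\<close>

section \<open>Independent sets and bases\<close>

lemma matroid_finite_ground: "matroid M \<Longrightarrow> finite (ground M)"
  by (simp add: matroid_def)

lemma indep_subset_ground: "matroid M \<Longrightarrow> I \<in> indeps M \<Longrightarrow> I \<subseteq> ground M"
  by (simp add: matroid_def)

lemma empty_indep: "matroid M \<Longrightarrow> {} \<in> indeps M"
  by (simp add: matroid_def)

lemma indep_mono: "matroid M \<Longrightarrow> I \<in> indeps M \<Longrightarrow> J \<subseteq> I \<Longrightarrow> J \<in> indeps M"
  unfolding matroid_def by blast

lemma indep_augment:
  "matroid M \<Longrightarrow> I \<in> indeps M \<Longrightarrow> J \<in> indeps M \<Longrightarrow> card I < card J
    \<Longrightarrow> \<exists>x\<in>J - I. insert x I \<in> indeps M"
  unfolding matroid_def by blast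

lemma matroidI:
  assumes "finite (ground M)" "\<And>I. I \<in> indeps M \<Longrightarrow> I \<subseteq> ground M" "{} \<in> indeps M"
    "\<And>I J. I \<in> indeps M \<Longrightarrow> J \<subseteq> I \<Longrightarrow> J \<in> indeps M"
    "\<And>I J. I \<in> indeps M \<Longrightarrow> J \<in> indeps M \<Longrightarrow> card I < card J
      \<Longrightarrow> \<exists>x\<in>J - I. insert x I \<in> indeps M"
  shows "matroid M"
  using assms unfolding matroid_def by blast

lemma indep_finite: "matroid M \<Longrightarrow> I \<in> indeps M \<Longrightarrow> finite I"
  using matroid_finite_ground indep_subset_ground finite_subset by metis

lemma finite_indeps: "matroid M \<Longrightarrow> finite (indeps M)"
  by (rule finite_subset[of _ "Pow (ground M)"])
    (auto simp: matroid_finite_ground dest: indep_subset_ground)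

lemma card_indep_le_rank: "matroid M \<Longrightarrow> I \<in> indeps M \<Longrightarrow> card I \<le> rank M"
  by (simp add: rank_def finite_indeps)

lemma rank_attained: "matroid M \<Longrightarrow> \<exists>I\<in>indeps M. card I = rank M"
  using Max_in[of "card ` indeps M"] finite_indeps[of M] empty_indep[of M]
  unfolding rank_def by (metis empty_iff finite_imageI image_iff)

lemma rank_le_card_ground:
  assumes M: "matroid M"
  shows "rank M \<le> card (ground M)"
proof -
  obtain I where "I \<in> indeps M" "card I = rank M" using rank_attained[OF M] by blast
  then show ?thesis
    using card_mono[OF matroid_finite_ground[OF M] indep_subset_ground[OF M]] by metis
qed

lemma rank_eqI:
  assumes "matroid M" "I \<in> indeps M" "card I = k" "\<And>J. J \<in> indeps M \<Longrightarrow> card J \<le> k"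
  shows "rank M = k"
  using assms card_indep_le_rank rank_attained by (metis le_antisym)

text \<open>
  Repeated augmentation, keeping track of where the new elements come from and stopping at a
  prescribed size.
\<close>

lemma indep_extend_within:
  assumes "matroid M" "I \<in> indeps M" "J \<in> indeps M" "card I \<le> k" "k \<le> card J"
  shows "\<exists>K\<in>indeps M. I \<subseteq> K \<and> K \<subseteq> I \<union> J \<and> card K = k"
  using assms(4,5)
proof (induction k rule: dec_induct)
  case base
  show ?case using assms by blast
next
  case (step k)
  then obtain K where K: "K \<in> indeps M" "I \<subseteq> K" "K \<subseteq> I \<union> J" "card K = k"
    by auto
  then obtain x where "x \<in> J - K" "insert x K \<in> indeps M"
    using indep_augment[OF assms(1) K(1) assms(3)] step by auto
  then show ?case
    using K indep_finite[OF assms(1) K(1)] by (intro bexI[of _ "insert x K"]) auto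
qed

lemma basis_iff_card:
  assumes "matroid M"
  shows "basis M B \<longleftrightarrow> B \<in> indeps M \<and> card B = rank M"
proof
  assume B: "basis M B"
  then have ind: "B \<in> indeps M" by (simp add: basis_def)
  obtain J where J: "J \<in> indeps M" "card J = rank M"
    using rank_attained[OF assms] by blast
  have "\<not> card B < card J"
    using indep_augment[OF assms ind J(1)] B unfolding basis_def by blast
  then show "B \<in> indeps M \<and> card B = rank M"
    using ind J card_indep_le_rank[OF assms ind] by simp
next
  assume B: "B \<in> indeps M \<and> card B = rank M"
  then show "basis M B"
    unfolding basis_def
    using card_indep_le_rank[OF assms] indep_finite[OF assms] by (metis card_seteq)
qed

lemma basis_extend_within:
  assumes "matroid M" "I \<in> indeps M" "basis M B"
  shows "\<exists>K. basis M K \<and> I \<subseteq> K \<and> K \<subseteq> I \<union> B"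
  using indep_extend_within[OF assms(1,2), of B "rank M"] assms
    card_indep_le_rank[OF assms(1,2)] by (auto simp: basis_iff_card)

lemma basis_exists: "matroid M \<Longrightarrow> \<exists>B. basis M B"
  using rank_attained by (auto simp: basis_iff_card)

lemma basis_subset_ground: "matroid M \<Longrightarrow> basis M B \<Longrightarrow> B \<subseteq> ground M"
  by (simp add: basis_def indep_subset_ground)

section \<open>Duality\<close>

lemma ground_dual [simp]: "ground (dual M) = ground M"
  by (simp add: dual_def)

lemma indeps_dual: "X \<in> indeps (dual M) \<longleftrightarrow> (\<exists>B. basis M B \<and> X \<subseteq> ground M - B)"
  by (simp add: dual_def)

text \<open>
  To augment \<open>X\<close> from \<open>Y\<close> in the dual, take a basis \<open>B\<close> avoiding \<open>Y\<close> and complete \<open>B - X\<close> to a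
  basis \<open>K\<close> inside the complement of \<open>X\<close>. If \<open>K\<close> contained all of \<open>Y - X\<close> it would have more elements
  than \<open>B\<close>, so some \<open>y\<close> in \<open>Y - X\<close> is avoided by \<open>K\<close>.
\<close>

lemma matroid_dual:
  assumes M: "matroid M"
  shows "matroid (dual M)"
proof (rule matroidI)
  show "finite (ground (dual M))" using M by (simp add: matroid_finite_ground)
  show "{} \<in> indeps (dual M)" using basis_exists[OF M] by (auto simp: indeps_dual)
  fix X Y assume "X \<in> indeps (dual M)" "Y \<in> indeps (dual M)" and less: "card X < card Y"
  then obtain A B where A: "basis M A" "X \<subseteq> ground M - A" and B: "basis M B" "Y \<subseteq> ground M - B"
    by (auto simp: indeps_dual)
  have "B - X \<in> indeps M" using B M by (auto simp: basis_def intro: indep_mono)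
  then obtain K where K: "basis M K" "B - X \<subseteq> K" "K \<subseteq> (B - X) \<union> A"
    using basis_extend_within[OF M _ A(1)] by blast
  have fin: "finite X" "finite Y" "finite B" "finite K"
    using A(2) B(2) basis_subset_ground[OF M B(1)] basis_subset_ground[OF M K(1)]
      matroid_finite_ground[OF M]
    by (auto intro: finite_subset)
  have "\<not> Y - X \<subseteq> K"
  proof
    assume sub: "Y - X \<subseteq> K"
    have "card (B \<inter> X) \<le> card (X - Y)" using B fin by (intro card_mono) auto
    moreover have "card (X - Y) < card (Y - X)"
      using less fin by (metis card_less_sym_Diff)
    moreover have "card ((B - X) \<union> (Y - X)) = card (B - X) + card (Y - X)"
      using B fin by (intro card_Un_disjoint) auto
    moreover have "card ((B - X) \<union> (Y - X)) \<le> card K"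
      using sub K fin by (intro card_mono) auto
    moreover have "card B = card (B - X) + card (B \<inter> X)"
      using fin by (metis Int_commute add.commute card_Int_Diff inf_commute)
    moreover have "card B = card K" using B(1) K(1) M by (simp add: basis_iff_card)
    ultimately show False by linarith
  qed
  then obtain y where "y \<in> Y - X" "y \<notin> K" by blast
  then show "\<exists>y\<in>Y - X. insert y X \<in> indeps (dual M)"
    using K A B by (intro bexI[of _ y]) (auto simp: indeps_dual intro!: exI[of _ K])
qed (auto simp: indeps_dual)

lemma rank_dual:
  assumes M: "matroid M"
  shows "rank (dual M) = card (ground M) - rank M"
proof -
  have eq: "card (ground M - B) = card (ground M) - rank M" if "basis M B" for B
    using that M basis_subset_ground[OF M that] matroid_finite_ground[OF M]
    by (simp add: basis_iff_card card_Diff_subset finite_subset)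
  obtain B where B: "basis M B" using basis_exists[OF M] by blast
  show ?thesis
  proof (rule rank_eqI[OF matroid_dual[OF M]])
    show "ground M - B \<in> indeps (dual M)" using B by (auto simp: indeps_dual)
    show "card J \<le> card (ground M) - rank M" if "J \<in> indeps (dual M)" for J
      using that eq matroid_finite_ground[OF M]
      by (metis card_mono finite_Diff indeps_dual)
  qed (rule eq[OF B])
qed

lemma basis_dual:
  assumes M: "matroid M"
  shows "basis (dual M) X \<longleftrightarrow> X \<subseteq> ground M \<and> basis M (ground M - X)"
proof -
  have eq: "card (ground M - B) = card (ground M) - rank M" if "basis M B" for B
    using that M basis_subset_ground[OF M that] matroid_finite_ground[OF M]
    by (simp add: basis_iff_card card_Diff_subset finite_subset)
  have dbl: "ground M - (ground M - Z) = Z" if "Z \<subseteq> ground M" for Z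
    using that by blast
  show ?thesis
  proof
    assume "basis (dual M) X"
    then have X: "X \<in> indeps (dual M)" "card X = card (ground M) - rank M"
      using basis_iff_card[OF matroid_dual[OF M]] rank_dual[OF M] by auto
    then obtain B where B: "basis M B" "X \<subseteq> ground M - B" by (auto simp: indeps_dual)
    then have "X = ground M - B"
      using X(2) eq[OF B(1)] matroid_finite_ground[OF M] by (intro card_subset_eq) auto
    then show "X \<subseteq> ground M \<and> basis M (ground M - X)"
      using B dbl[OF basis_subset_ground[OF M B(1)]] by auto
  next
    assume X: "X \<subseteq> ground M \<and> basis M (ground M - X)"
    then have "X \<in> indeps (dual M)" by (auto simp: indeps_dual)
    moreover have "card X = card (ground M) - rank M"
      using X eq[of "ground M - X"] dbl[of X] by simp
    ultimately show "basis (dual M) X"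
      by (simp add: basis_iff_card[OF matroid_dual[OF M]] rank_dual[OF M])
  qed
qed

lemma dual_dual:
  assumes M: "matroid M"
  shows "dual (dual M) = M"
proof -
  have "X \<in> indeps (dual (dual M)) \<longleftrightarrow> X \<in> indeps M" for X
  proof
    assume "X \<in> indeps (dual (dual M))"
    then obtain B where "basis M (ground M - B)" "X \<subseteq> ground M - B"
      by (auto simp: indeps_dual[of _ "dual M"] basis_dual[OF M])
    then show "X \<in> indeps M" using indep_mono[OF M] unfolding basis_def by blast
  next
    assume X: "X \<in> indeps M"
    then obtain B where B: "basis M B" "X \<subseteq> B"
      using basis_extend_within[OF M] basis_exists[OF M] by blast
    moreover have "ground M - (ground M - B) = B"
      using basis_subset_ground[OF M B(1)] by blast
    ultimately show "X \<in> indeps (dual (dual M))"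
      by (auto simp: indeps_dual[of _ "dual M"] basis_dual[OF M] intro!: exI[of _ "ground M - B"])
  qed
  then show ?thesis by (intro set_system.equality) auto
qed

section \<open>Relabelling\<close>

lemma ground_relabel [simp]: "ground (relabel h M) = h ` ground M"
  by (simp add: relabel_def)

lemma indeps_relabel: "indeps (relabel h M) = (\<lambda>I. h ` I) ` indeps M"
  by (simp add: relabel_def)

lemma matroid_relabel:
  assumes M: "matroid M" and inj: "inj_on h (ground M)"
  shows "matroid (relabel h M)"
proof (rule matroidI)
  show "finite (ground (relabel h M))" using M by (simp add: matroid_finite_ground)
  show "I \<subseteq> ground (relabel h M)" if "I \<in> indeps (relabel h M)" for I
    using that indep_subset_ground[OF M] by (auto simp: indeps_relabel)
  show "{} \<in> indeps (relabel h M)" using empty_indep[OF M] by (auto simp: indeps_relabel)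
  show "J \<in> indeps (relabel h M)" if "I \<in> indeps (relabel h M)" "J \<subseteq> I" for I J
  proof -
    from that obtain I' where I': "I' \<in> indeps M" "J \<subseteq> h ` I'" by (auto simp: indeps_relabel)
    then obtain J' where "J' \<subseteq> I'" "J = h ` J'" by (auto simp: subset_image_iff)
    then show ?thesis using indep_mono[OF M I'(1)] by (auto simp: indeps_relabel)
  qed
  fix I J assume "I \<in> indeps (relabel h M)" "J \<in> indeps (relabel h M)" and less: "card I < card J"
  then obtain I' J' where IJ: "I' \<in> indeps M" "I = h ` I'" "J' \<in> indeps M" "J = h ` J'"
    by (auto simp: indeps_relabel)
  have sub: "I' \<subseteq> ground M" "J' \<subseteq> ground M" using IJ indep_subset_ground[OF M] by auto
  then have "card I' < card J'"
    using less IJ inj by (metis card_image inj_on_subset)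
  then obtain x where x: "x \<in> J' - I'" "insert x I' \<in> indeps M"
    using indep_augment[OF M IJ(1,3)] by blast
  then have "h x \<in> J - I" using IJ sub inj by (auto dest: inj_onD)
  moreover have "insert (h x) I \<in> indeps (relabel h M)"
    using x IJ by (auto simp: indeps_relabel intro!: image_eqI[of _ _ "insert x I'"])
  ultimately show "\<exists>x\<in>J - I. insert x I \<in> indeps (relabel h M)" by blast
qed

lemma rank_relabel:
  assumes M: "matroid M" and inj: "inj_on h (ground M)"
  shows "rank (relabel h M) = rank M"
proof -
  have "card (h ` I) = card I" if "I \<in> indeps M" for I
    using that indep_subset_ground[OF M that] inj by (metis card_image inj_on_subset)
  then show ?thesis
    unfolding rank_def indeps_relabel image_image by (metis (no_types, lifting) image_cong)
qed

lemma relabel_the_Some [simp]: "relabel the (relabel Some M) = M"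
  by (simp add: relabel_def image_image)

section \<open>Truncation and elongation\<close>

definition trunc :: "'a set_system \<Rightarrow> 'a set_system" where
  "trunc M = \<lparr>ground = ground M, indeps = {I \<in> indeps M. card I < rank M}\<rparr>"

text \<open>
  The sets of nullity at most one, that is, those becoming independent after the removal of at most
  one element; Welsh calls this matroid the elongation.
\<close>

definition elongate :: "'a set_system \<Rightarrow> 'a set_system" where
  "elongate M = \<lparr>ground = ground M,
     indeps = {X. X \<subseteq> ground M \<and> (\<exists>I\<in>indeps M. I \<subseteq> X \<and> card X \<le> card I + 1)}\<rparr>"

lemma ground_trunc [simp]: "ground (trunc M) = ground M"
  by (simp add: trunc_def)

lemma ground_elongate [simp]: "ground (elongate M) = ground M"
  by (simp add: elongate_def)

lemma indeps_trunc: "I \<in> indeps (trunc M) \<longleftrightarrow> I \<in> indeps M \<and> card I < rank M"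
  by (simp add: trunc_def)

lemma indeps_elongate:
  "X \<in> indeps (elongate M) \<longleftrightarrow>
    X \<subseteq> ground M \<and> (\<exists>I\<in>indeps M. I \<subseteq> X \<and> card X \<le> card I + 1)"
  by (simp add: elongate_def)

lemma matroid_trunc:
  assumes M: "matroid M" and r: "rank M > 0"
  shows "matroid (trunc M)"
proof (rule matroidI)
  fix I J assume I: "I \<in> indeps (trunc M)" and J: "J \<in> indeps (trunc M)"
    and less: "card I < card J"
  then obtain x where x: "x \<in> J - I" "insert x I \<in> indeps M"
    using indep_augment[OF M] by (auto simp: indeps_trunc)
  then have "card (insert x I) \<le> card J"
    using less I indep_finite[OF M] by (auto simp: indeps_trunc)
  then show "\<exists>x\<in>J - I. insert x I \<in> indeps (trunc M)"
    using x J by (auto simp: indeps_trunc)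
next
  fix I J assume I: "I \<in> indeps (trunc M)" "J \<subseteq> I"
  then have "card J \<le> card I" using indep_finite[OF M] by (auto simp: indeps_trunc intro: card_mono)
  then show "J \<in> indeps (trunc M)" using I indep_mono[OF M] by (auto simp: indeps_trunc)
qed (use M r in \<open>auto simp: indeps_trunc matroid_finite_ground empty_indep
      dest: indep_subset_ground\<close>)

lemma rank_trunc:
  assumes M: "matroid M" and r: "rank M > 0"
  shows "rank (trunc M) = rank M - 1"
proof -
  obtain J where J: "J \<in> indeps M" "card J = rank M" using rank_attained[OF M] by blast
  obtain I where "I \<in> indeps M" "card I = rank M - 1"
    using indep_extend_within[OF M empty_indep[OF M] J(1), of "rank M - 1"] J by auto
  then show ?thesis
    using r by (intro rank_eqI[OF matroid_trunc[OF assms]]) (auto simp: indeps_trunc)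
qed

text \<open>
  The bases of the truncation are the bases of \<open>M\<close> with one element removed. Their complements are
  the cobases with one element added, whose subsets are exactly the sets of nullity at most one in the dual.
\<close>

lemma dual_trunc:
  assumes M: "matroid M" and r: "rank M > 0"
  shows "dual (trunc M) = elongate (dual M)"
proof -
  have bas: "basis (trunc M) I \<longleftrightarrow> I \<in> indeps M \<and> card I = rank M - 1" for I
    using r by (auto simp: basis_iff_card[OF matroid_trunc[OF assms]] rank_trunc[OF assms]
        indeps_trunc)
  have "X \<in> indeps (dual (trunc M)) \<longleftrightarrow> X \<in> indeps (elongate (dual M))" for X
  proof
    assume "X \<in> indeps (dual (trunc M))"
    then obtain I where I: "I \<in> indeps M" "card I = rank M - 1" "X \<subseteq> ground M - I"
      by (auto simp: indeps_dual bas)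
    obtain B where B: "basis M B" "I \<subseteq> B"
      using basis_extend_within[OF M I(1)] basis_exists[OF M] by blast
    have finB: "finite B" and finX: "finite X"
      using basis_subset_ground[OF M B(1)] I(3) matroid_finite_ground[OF M]
      by (auto intro: finite_subset)
    have "card (B - I) = 1"
      using B I r finB M by (simp add: card_Diff_subset finite_subset basis_iff_card)
    have "card (X \<inter> B) \<le> card (B - I)" using I(3) finB by (intro card_mono) auto
    with \<open>card (B - I) = 1\<close> have "card X \<le> card (X - B) + 1"
      using card_Int_Diff[OF finX, of B] by simp
    moreover have "X - B \<in> indeps (dual M)" using B(1) I(3) by (auto simp: indeps_dual)
    ultimately show "X \<in> indeps (elongate (dual M))"
      using I(3) by (auto simp: indeps_elongate intro!: bexI[of _ "X - B"])
  next
    assume "X \<in> indeps (elongate (dual M))"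
    then obtain Y B where X: "X \<subseteq> ground M" "Y \<subseteq> X" "card X \<le> card Y + 1"
      and B: "basis M B" "Y \<subseteq> ground M - B"
      by (auto simp: indeps_elongate indeps_dual)
    have finB: "finite B" and finX: "finite X"
      using basis_subset_ground[OF M B(1)] X(1) matroid_finite_ground[OF M]
      by (auto intro: finite_subset)
    have "card (X \<inter> B) \<le> card (X - Y)" using B(2) finX by (intro card_mono) auto
    also have "\<dots> \<le> 1" using X finX by (simp add: card_Diff_subset finite_subset)
    finally have one: "card (X \<inter> B) \<le> 1" .
    have cB: "card B = rank M" and iB: "B \<in> indeps M" using B(1) M by (auto simp: basis_iff_card)
    have "\<exists>b\<in>B. X \<inter> B \<subseteq> {b}"
    proof (cases "X \<inter> B = {}")
      case True
      moreover have "B \<noteq> {}" using cB r by auto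
      ultimately show ?thesis by blast
    next
      case False
      then obtain b where b: "b \<in> X \<inter> B" by blast
      then have "X \<inter> B \<subseteq> {b}"
        using one finX card_le_Suc0_iff_eq[of "X \<inter> B"] by auto
      then show ?thesis using b by blast
    qed
    then obtain b where b: "b \<in> B" "X \<inter> B \<subseteq> {b}" by blast
    have "B - {b} \<in> indeps M" using indep_mono[OF M iB] by blast
    moreover have "card (B - {b}) = rank M - 1" using b finB cB by simp
    ultimately show "X \<in> indeps (dual (trunc M))"
      using X(1) b by (auto simp: indeps_dual bas intro!: exI[of _ "B - {b}"])
  qed
  then show ?thesis by (intro set_system.equality) auto
qed

lemma
  assumes M: "matroid M" and r: "rank M < card (ground M)"
  shows rank_elongate: "rank (elongate M) = rank M + 1"
    and matroid_elongate: "matroid (elongate M)"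
proof -
  have D: "matroid (dual M)" "rank (dual M) > 0"
    using matroid_dual[OF M] rank_dual[OF M] r by auto
  have eq: "elongate M = dual (trunc (dual M))"
    using dual_trunc[OF D] dual_dual[OF M] by simp
  show "matroid (elongate M)" unfolding eq by (intro matroid_dual matroid_trunc D)
  show "rank (elongate M) = rank M + 1"
    unfolding eq using r
    by (simp add: rank_dual[OF matroid_trunc[OF D]] rank_trunc[OF D] rank_dual[OF M])
qed

text \<open>
  If the independent set witnessing nullity at most one is already a basis of \<open>M\<close>, then the size bound
  makes it the whole of \<open>X\<close>, and dropping any one element gives a witness in the truncation.
\<close>

lemma indeps_elongate_trunc:
  assumes M: "matroid M" and r: "rank M > 0"
  shows "X \<in> indeps (elongate (trunc M)) \<longleftrightarrow>
    X \<in> indeps (elongate M) \<and> card X \<le> rank M"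
proof
  assume "X \<in> indeps (elongate (trunc M))"
  then obtain I where "X \<subseteq> ground M" "I \<in> indeps M" "card I < rank M" "I \<subseteq> X"
    "card X \<le> card I + 1"
    by (auto simp: indeps_elongate indeps_trunc)
  then show "X \<in> indeps (elongate M) \<and> card X \<le> rank M"
    unfolding indeps_elongate by auto
next
  assume X: "X \<in> indeps (elongate M) \<and> card X \<le> rank M"
  then obtain I where I: "X \<subseteq> ground M" "I \<in> indeps M" "I \<subseteq> X" "card X \<le> card I + 1"
    by (auto simp: indeps_elongate)
  have finX: "finite X" using I(1) matroid_finite_ground[OF M] finite_subset by blast
  have "card I \<le> card X" using I finX card_mono by blast
  show "X \<in> indeps (elongate (trunc M))"
  proof (cases "card I < rank M")
    case True
    then show ?thesis using I by (auto simp: indeps_elongate indeps_trunc)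
  next
    case False
    then have "card I = card X" "card X = rank M" using X \<open>card I \<le> card X\<close> by auto
    then obtain x where x: "x \<in> I" using r by (metis card.empty ex_in_conv less_irrefl)
    have "I - {x} \<in> indeps M" using indep_mono[OF M I(2)] by blast
    moreover have "card (I - {x}) = rank M - 1"
      using x \<open>card I = card X\<close> \<open>card X = rank M\<close> I(2) indep_finite[OF M] by simp
    ultimately show ?thesis
      using I(1,3) \<open>card X = rank M\<close> r
      by (auto simp: indeps_elongate indeps_trunc intro!: bexI[of _ "I - {x}"])
  qed
qed

lemma trunc_elongate:
  assumes M: "matroid M" and r: "rank M > 0" "rank M < card (ground M)"
  shows "trunc (elongate M) = elongate (trunc M)"
proof -
  have "X \<in> indeps (trunc (elongate M)) \<longleftrightarrow> X \<in> indeps (elongate (trunc M))" for X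
    by (auto simp: indeps_elongate_trunc[OF M r(1)] indeps_trunc rank_elongate[OF M r(2)])
  then show ?thesis by (intro set_system.equality) auto
qed

text \<open>
  The self-duality that makes the treatment of cocircuits the same as that of circuits.
\<close>

lemma dual_elongate_trunc:
  assumes M: "matroid M" and r: "rank M > 0" "rank M < card (ground M)"
  shows "dual (elongate (trunc M)) = elongate (trunc (dual M))"
proof -
  have D: "matroid (dual M)" "rank (dual M) > 0" "rank (dual M) < card (ground (dual M))"
    using matroid_dual[OF M] rank_dual[OF M] r by auto
  have e: "matroid (elongate M)" "rank (elongate M) > 0"
    using rank_elongate[OF M r(2)] matroid_elongate[OF M r(2)] by auto
  have t: "matroid (trunc (dual M))" by (rule matroid_trunc[OF D(1,2)])
  have "dual (elongate (trunc M)) = elongate (dual (elongate M))"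
    using trunc_elongate[OF M r] dual_trunc[OF e] by simp
  also have "dual (elongate M) = trunc (dual M)"
    using dual_trunc[OF D(1,2)] dual_dual[OF M] dual_dual[OF t] by simp
  finally show ?thesis .
qed

section \<open>Free extensions\<close>

lemma matroid_delete:
  assumes M: "matroid M"
  shows "matroid (delete M T)"
proof (rule matroidI)
  fix I J assume I: "I \<in> indeps (delete M T)" and J: "J \<in> indeps (delete M T)"
    and less: "card I < card J"
  then obtain x where "x \<in> J - I" "insert x I \<in> indeps M"
    using indep_augment[OF M, of I J] by (auto simp: delete_def)
  then show "\<exists>x\<in>J - I. insert x I \<in> indeps (delete M T)"
    using I J by (auto simp: delete_def)
qed (use M in \<open>auto simp: delete_def matroid_finite_ground empty_indep
      dest: indep_subset_ground intro: indep_mono\<close>)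

text \<open>
  Since \<open>f\<close> is not a loop, some cobasis avoids it, so deleting \<open>f\<close> from the dual keeps the rank; the
  bases of that deletion are then the complements of the bases of \<open>M\<close> that contain \<open>f\<close>.
\<close>

lemma indeps_contract_single:
  assumes M: "matroid M" and f: "{f} \<in> indeps M"
  shows "I \<in> indeps (contract M {f}) \<longleftrightarrow> f \<notin> I \<and> insert f I \<in> indeps M"
proof -
  let ?D = "delete (dual M) {f}"
  have D: "matroid ?D" by (intro matroid_delete matroid_dual M)
  have gr: "ground ?D = ground M - {f}" by (simp add: delete_def)
  have ind: "X \<in> indeps ?D \<longleftrightarrow> X \<in> indeps (dual M) \<and> f \<notin> X" for X
    by (auto simp: delete_def)
  obtain B where B: "basis M B" "f \<in> B"
    using basis_extend_within[OF M f] basis_exists[OF M] by blast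
  have "ground M - (ground M - B) = B" using basis_subset_ground[OF M B(1)] by blast
  then have "basis (dual M) (ground M - B)" using B by (simp add: basis_dual[OF M])
  then have "ground M - B \<in> indeps (dual M)" "card (ground M - B) = rank (dual M)"
    using basis_iff_card[OF matroid_dual[OF M]] by auto
  then have rk: "rank ?D = rank (dual M)"
    using B card_indep_le_rank[OF matroid_dual[OF M]] by (intro rank_eqI[OF D]) (auto simp: ind)
  have bas: "basis ?D X \<longleftrightarrow> X \<subseteq> ground M \<and> basis M (ground M - X) \<and> f \<notin> X" for X
    using basis_dual[OF M] basis_iff_card[OF matroid_dual[OF M]]
    by (auto simp: basis_iff_card[OF D] rk ind)
  show ?thesis
  proof
    assume "I \<in> indeps (contract M {f})"
    then obtain X where X: "X \<subseteq> ground M" "basis M (ground M - X)" "f \<notin> X"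
      "I \<subseteq> ground M - {f} - X"
      by (auto simp: contract_def indeps_dual[of _ ?D] gr bas)
    have "insert f I \<subseteq> ground M - X"
      using X f indep_subset_ground[OF M f] by auto
    then show "f \<notin> I \<and> insert f I \<in> indeps M"
      using X indep_mono[OF M] by (auto simp: basis_def)
  next
    assume I: "f \<notin> I \<and> insert f I \<in> indeps M"
    then obtain K where K: "basis M K" "insert f I \<subseteq> K"
      using basis_extend_within[OF M] basis_exists[OF M] by blast
    have "K \<subseteq> ground M" by (rule basis_subset_ground[OF M K(1)])
    then have "ground M - (ground M - K) = K" by blast
    then show "I \<in> indeps (contract M {f})"
      using K I \<open>K \<subseteq> ground M\<close>
      by (auto simp: contract_def indeps_dual[of _ ?D] gr bas intro!: exI[of _ "ground M - K"])
  qed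
qed

lemma ground_free_extension [simp]: "ground (free_extension M f) = insert f (ground M)"
  by (simp add: free_extension_def)

lemma indeps_free_extension:
  assumes M: "matroid M" and f: "f \<notin> ground M"
  shows "X \<in> indeps (free_extension M f) \<longleftrightarrow>
    X - {f} \<in> indeps M \<and> (f \<in> X \<longrightarrow> card (X - {f}) < rank M)"
proof (cases "f \<in> X")
  case True
  have "X \<notin> indeps M" using True f indep_subset_ground[OF M] by blast
  moreover have "(\<exists>I. X = insert f I \<and> I \<in> indeps M \<and> card I < rank M) \<longleftrightarrow>
      X - {f} \<in> indeps M \<and> card (X - {f}) < rank M"
    (is "?L \<longleftrightarrow> ?R")
  proof
    assume ?L
    then obtain I where I: "X = insert f I" "I \<in> indeps M" "card I < rank M" by blast
    then have "X - {f} = I" using f indep_subset_ground[OF M] by blast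
    with I show ?R by simp
  next
    assume ?R
    then show ?L using True by (intro exI[of _ "X - {f}"]) auto
  qed
  ultimately show ?thesis using True by (simp add: free_extension_def)
next
  case False
  then show ?thesis by (auto simp: free_extension_def)
qed

lemma matroid_free_extension:
  assumes M: "matroid M" and f: "f \<notin> ground M"
  shows "matroid (free_extension M f)"
proof (rule matroidI)
  note ind = indeps_free_extension[OF M f]
  show "finite (ground (free_extension M f))" using M by (simp add: matroid_finite_ground)
  show "I \<subseteq> ground (free_extension M f)" if "I \<in> indeps (free_extension M f)" for I
    using that indep_subset_ground[OF M] by (auto simp: ind)
  show "{} \<in> indeps (free_extension M f)" using empty_indep[OF M] by (simp add: ind)
  show "J \<in> indeps (free_extension M f)" if I: "I \<in> indeps (free_extension M f)" and "J \<subseteq> I" for I J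
  proof -
    have "J - {f} \<subseteq> I - {f}" using \<open>J \<subseteq> I\<close> by blast
    moreover have "I - {f} \<in> indeps M" using I by (simp add: ind)
    ultimately have "J - {f} \<in> indeps M" "card (J - {f}) \<le> card (I - {f})"
      using indep_mono[OF M] indep_finite[OF M] card_mono by metis+
    then show ?thesis using I \<open>J \<subseteq> I\<close> by (auto simp: ind)
  qed
  fix I J assume I: "I \<in> indeps (free_extension M f)" and J: "J \<in> indeps (free_extension M f)"
    and less: "card I < card J"
  let ?I = "I - {f}" and ?J = "J - {f}"
  have iI: "?I \<in> indeps M" and iJ: "?J \<in> indeps M" using I J by (auto simp: ind)
  have fin: "finite I" "finite J" using indep_finite[OF M iI] indep_finite[OF M iJ] by auto
  have cI: "f \<in> I \<Longrightarrow> Suc (card ?I) = card I" "f \<notin> I \<Longrightarrow> ?I = I"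
    using card_Suc_Diff1[OF fin(1)] by auto
  have cJ: "f \<in> J \<Longrightarrow> Suc (card ?J) = card J" "f \<notin> J \<Longrightarrow> ?J = J"
    using card_Suc_Diff1[OF fin(2)] by auto
  show "\<exists>x\<in>J - I. insert x I \<in> indeps (free_extension M f)"
  proof (cases "f \<in> J \<and> f \<notin> I")
    case True
    then have "card ?J < rank M" using J unfolding ind by blast
    then have "card I < rank M" using less cJ(1) True by linarith
    then have "insert f I \<in> indeps (free_extension M f)" using True iI by (simp add: ind)
    then show ?thesis using True by blast
  next
    case False
    have lt: "card ?I < card ?J"
      using less cI cJ False by (metis Suc_less_eq Suc_lessD)
    have lt': "card ?I + 1 < rank M" if "f \<in> I"
    proof (cases "f \<in> J")
      case True
      then have "card ?J < rank M" using J unfolding ind by blast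
      then show ?thesis using lt by linarith
    next
      case False
      then have "card ?I + 1 < card ?J" using less cI(1)[OF that] cJ(2) by simp
      then show ?thesis using card_indep_le_rank[OF M iJ] by linarith
    qed
    obtain x where x: "x \<in> ?J - ?I" "insert x ?I \<in> indeps M"
      using indep_augment[OF M iI iJ lt] by blast
    have eq: "insert x I - {f} = insert x ?I" using x by auto
    have "card (insert x ?I) = card ?I + 1" using x fin by auto
    have "insert x I \<in> indeps (free_extension M f)" 
      unfolding ind eq using x(2) lt' x(1) \<open>card (insert x ?I) = card ?I + 1\<close> by (metis DiffD1 DiffD2
        insert_iff)
    then show ?thesis using x by blast
  qed
qed

lemma contract_free_extension:
  assumes M: "matroid M" and f: "f \<notin> ground M" and r: "rank M > 0"
  shows "contract (free_extension M f) {f} = trunc M"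
proof -
  note ind = indeps_free_extension[OF M f]
  have F: "matroid (free_extension M f)" by (rule matroid_free_extension[OF M f])
  have "{f} \<in> indeps (free_extension M f)" using empty_indep[OF M] r by (simp add: ind)
  note con = indeps_contract_single[OF F this]
  have "I \<in> indeps (contract (free_extension M f) {f}) \<longleftrightarrow> I \<in> indeps (trunc M)" for I
  proof -
    have "f \<notin> I" if "I \<in> indeps M" using that f indep_subset_ground[OF M] by blast
    moreover have "insert f I - {f} = I" if "f \<notin> I" using that by blast
    ultimately show ?thesis by (auto simp: con ind indeps_trunc)
  qed
  moreover have "ground (contract (free_extension M f) {f}) = ground (trunc M)"
    using f by (simp add: contract_def delete_def)
  ultimately show ?thesis by (intro set_system.equality) auto
qed

text \<open>
  Contraction is defined as the dual of deletion in the dual, so this is the dual form of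
  \<open>contract_free_extension\<close>.
\<close>

lemma delete_free_coextension:
  assumes M: "matroid M" and f: "f \<notin> ground M" and r: "rank M < card (ground M)"
  shows "delete (free_coextension M f) {f} = elongate M"
proof -
  have D: "matroid (dual M)" "rank (dual M) > 0" "f \<notin> ground (dual M)"
    using matroid_dual[OF M] rank_dual[OF M] r f by auto
  let ?F = "free_extension (dual M) f"
  have F: "matroid ?F" by (rule matroid_free_extension[OF D(1,3)])
  have "delete (dual ?F) {f} = dual (contract ?F {f})"
    unfolding contract_def by (rule dual_dual[OF matroid_delete[OF matroid_dual[OF F]], symmetric])
  also have "\<dots> = dual (trunc (dual M))" using contract_free_extension[OF D(1,3,2)] by simp
  also have "\<dots> = elongate M" using dual_trunc[OF D(1,2)] dual_dual[OF M] by simp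
  finally show ?thesis by (simp add: free_coextension_def)
qed

lemma trunc_relabel:
  assumes M: "matroid M" and inj: "inj_on h (ground M)"
  shows "trunc (relabel h M) = relabel h (trunc M)"
proof -
  have "card (h ` I) = card I" if "I \<in> indeps M" for I
    using that indep_subset_ground[OF M that] inj by (metis card_image inj_on_subset)
  then show ?thesis
    by (intro set_system.equality)
      (auto simp: trunc_def indeps_relabel rank_relabel[OF assms])
qed

lemma truncation_eq_trunc:
  assumes M: "matroid M" and r: "rank M > 0"
  shows "truncation M = trunc M"
proof -
  have inj: "inj_on Some (ground M)" by simp
  have "contract (free_extension (relabel Some M) None) {None} = relabel Some (trunc M)"
    using contract_free_extension[OF matroid_relabel[OF M inj]] r
    by (simp add: rank_relabel[OF M inj] trunc_relabel[OF M inj])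
  then show ?thesis by (simp add: truncation_def)
qed

lemma higgs_lift_eq_elongate:
  assumes M: "matroid M" and r: "rank M < card (ground M)"
  shows "higgs_lift M = elongate M"
proof -
  have inj: "inj_on Some (ground M)" by simp
  have D: "matroid (dual M)" "rank (dual M) > 0"
    using matroid_dual[OF M] rank_dual[OF M] r by auto
  have "delete (free_coextension (relabel Some M) None) {None} = elongate (relabel Some M)"
    using r by (intro delete_free_coextension matroid_relabel[OF M inj])
      (auto simp: rank_relabel[OF M inj] card_image)
  also have "\<dots> = relabel Some (elongate M)"
  proof -
    have "X \<in> indeps (elongate (relabel Some M)) \<longleftrightarrow> X \<in> indeps (relabel Some (elongate M))" for X
    proof (cases "X \<subseteq> Some ` ground M")
      case True
      then obtain Y where Y: "Y \<subseteq> ground M" "X = Some ` Y" by (auto simp: subset_image_iff)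
      have "X \<in> indeps (elongate (relabel Some M)) \<longleftrightarrow>
          (\<exists>I\<in>indeps M. Some ` I \<subseteq> Some ` Y \<and> card (Some ` Y) \<le> card (Some ` I) + 1)"
        using True Y by (simp add: indeps_elongate indeps_relabel)
      also have "\<dots> \<longleftrightarrow> Y \<in> indeps (elongate M)"
        using Y(1) by (simp add: indeps_elongate card_image inj_image_subset_iff)
      also have "\<dots> \<longleftrightarrow> X \<in> indeps (relabel Some (elongate M))"
        using Y(2) by (simp add: indeps_relabel image_iff inj_image_eq_iff)
      finally show ?thesis .
    next
      case False
      have "X \<notin> indeps (relabel Some (elongate M))"
      proof
        assume "X \<in> indeps (relabel Some (elongate M))"
        then obtain Y where "X = Some ` Y" "Y \<in> indeps (elongate M)"
          unfolding indeps_relabel by (rule imageE)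
        then show False using False by (simp add: indeps_elongate image_mono)
      qed
      then show ?thesis using False by (simp add: indeps_elongate)
    qed
    then show ?thesis by (intro set_system.equality) auto
  qed
  finally show ?thesis by (simp add: higgs_lift_def)
qed

section \<open>Circuits and cocircuits\<close>

lemma circuit_Diff_indep: "circuit M C \<Longrightarrow> x \<in> C \<Longrightarrow> C - {x} \<in> indeps M"
  unfolding circuit_def by blast

lemma circuit_not_subset_indep: "matroid M \<Longrightarrow> circuit M C \<Longrightarrow> I \<in> indeps M \<Longrightarrow> \<not> C \<subseteq> I"
  unfolding circuit_def by (metis indep_mono)

lemma cocircuit_dual: "matroid M \<Longrightarrow> cocircuit (dual M) C \<longleftrightarrow> circuit M C"
  by (simp add: cocircuit_def dual_dual)

text \<open>
  The union of two distinct circuits has nullity at least two. Pick \<open>x\<close> in \<open>C - D\<close>: if some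
  independent set missed at most one element of the union, one missing exactly one element could be
  grown from \<open>C - {x}\<close>; it would have to miss \<open>x\<close> and hence contain \<open>D\<close>.
\<close>

lemma card_indep_union_circuits:
  assumes M: "matroid M" and C: "circuit M C" "circuit M D" "C \<noteq> D"
    and I: "I \<in> indeps M" "I \<subseteq> C \<union> D"
  shows "card I + 2 \<le> card (C \<union> D)"
proof (rule ccontr)
  assume neg: "\<not> ?thesis"
  have "\<not> C \<subset> D" using C unfolding circuit_def by blast
  then obtain x where x: "x \<in> C" "x \<notin> D" using C(3) by blast
  have fin: "finite (C \<union> D)"
    using C matroid_finite_ground[OF M] by (auto simp: circuit_def intro: finite_subset)
  have sub: "C - {x} \<subseteq> (C \<union> D) - {x}" by blast
  have c: "card ((C \<union> D) - {x}) = card (C \<union> D) - 1" using x fin by simp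
  have "card (C - {x}) \<le> card (C \<union> D) - 1"
    using card_mono[OF _ sub] fin c by simp
  moreover have "card (C \<union> D) - 1 \<le> card I" using neg by simp
  ultimately obtain K where K: "K \<in> indeps M" "C - {x} \<subseteq> K" "K \<subseteq> (C - {x}) \<union> I"
    "card K = card (C \<union> D) - 1"
    using indep_extend_within[OF M circuit_Diff_indep[OF C(1) x(1)] I(1)] by blast
  have "x \<notin> K"
  proof
    assume "x \<in> K"
    then have "C \<subseteq> K" using K(2) by blast
    then show False using circuit_not_subset_indep[OF M C(1) K(1)] by blast
  qed
  then have "K \<subseteq> (C \<union> D) - {x}" using K(3) I(2) by blast
  then have "K = (C \<union> D) - {x}" using K(4) c fin by (intro card_subset_eq) auto
  then have "D \<subseteq> K" using x by blast
  then show False using circuit_not_subset_indep[OF M C(2) K(1)] by blast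
qed

text \<open>
  Every \<open>x\<close> in the union lies in one of the two circuits, \<open>Z\<close> say. Growing \<open>Z - {x}\<close> to the size of \<open>J\<close>
  cannot pick up \<open>x\<close> again, so removing \<open>x\<close> brings the nullity down to
  at most one.
\<close>

lemma circuit_elongate_trunc:
  assumes M: "matroid M" and C: "circuit M C" "circuit M D" "C \<noteq> D"
    and J: "J \<in> indeps M" "J \<subseteq> C \<union> D" "card (C \<union> D) \<le> card J + 2"
    and r: "rank M > 0" "card (C \<union> D) \<le> rank M + 1"
  shows "circuit (elongate (trunc M)) (C \<union> D)"
proof -
  have sub: "C \<union> D \<subseteq> ground M" using C by (auto simp: circuit_def)
  then have fin: "finite (C \<union> D)" using matroid_finite_ground[OF M] finite_subset by blast
  have "C \<union> D \<notin> indeps (elongate (trunc M))"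
  proof
    assume "C \<union> D \<in> indeps (elongate (trunc M))"
    then have "C \<union> D \<in> indeps (elongate M)" by (simp add: indeps_elongate_trunc[OF M r(1)])
    then obtain I where I: "I \<in> indeps M" "I \<subseteq> C \<union> D" "card (C \<union> D) \<le> card I + 1"
      unfolding indeps_elongate by blast
    show False using card_indep_union_circuits[OF M C I(1,2)] I(3) by simp
  qed
  moreover have "X \<in> indeps (elongate (trunc M))" if X: "X \<subset> C \<union> D" for X
  proof -
    obtain x where x: "x \<in> C \<union> D" "x \<notin> X" using X by blast
    then obtain Z where Z: "circuit M Z" "x \<in> Z" "Z \<subseteq> C \<union> D"
      using C(1,2) by (metis Un_iff Un_upper1 Un_upper2)
    have cJ: "card (Z - {x}) \<le> card J"
    proof -
      have "card (Z - {x}) + 2 \<le> card (C \<union> D)"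
        using Z(3) by (intro card_indep_union_circuits[OF M C circuit_Diff_indep[OF Z(1,2)]]) auto
      then show ?thesis using J(3) by simp
    qed
    obtain K where K: "K \<in> indeps M" "Z - {x} \<subseteq> K" "K \<subseteq> (Z - {x}) \<union> J" "card K = card J"
      using indep_extend_within[OF M circuit_Diff_indep[OF Z(1,2)] J(1) cJ le_refl] by blast
    have "x \<notin> K"
    proof
      assume "x \<in> K"
      then have "Z \<subseteq> K" using K(2) by blast
      then show False using circuit_not_subset_indep[OF M Z(1) K(1)] by blast
    qed
    let ?Y = "(C \<union> D) - {x}"
    have cY: "card ?Y = card (C \<union> D) - 1" using x fin by simp
    have "?Y \<in> indeps (elongate M)"
      unfolding indeps_elongate
    proof (intro conjI bexI[of _ K])
      show "K \<subseteq> ?Y" using K(3) Z(3) J(2) \<open>x \<notin> K\<close> by blast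
      show "card ?Y \<le> card K + 1" using cY K(4) J(3) by simp
    next
      show "?Y \<subseteq> ground M" using sub by blast
    qed (rule K(1))
    moreover have "card ?Y \<le> rank M" using cY r(2) by simp
    ultimately have Y: "?Y \<in> indeps (elongate (trunc M))" by (simp add: indeps_elongate_trunc[OF M r(1)])
    have t: "matroid (trunc M)" by (rule matroid_trunc[OF M r(1)])
    have "0 < card (ground M)"
      using sub x(1) matroid_finite_ground[OF M] by (auto simp: card_gt_0_iff)
    moreover have "rank M \<le> card (ground M)" by (rule rank_le_card_ground[OF M])
    ultimately have "rank (trunc M) < card (ground (trunc M))"
      using r(1) by (simp add: rank_trunc[OF M r(1)])
    then have "matroid (elongate (trunc M))" by (rule matroid_elongate[OF t])
    then show ?thesis by (rule indep_mono[OF _ Y]) (use X x(2) in blast)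
  qed
  ultimately show ?thesis using sub by (simp add: circuit_def)
qed

text \<open>
  A cocircuit is a minimal set meeting all bases. Hence some basis \<open>B\<close> meets \<open>D\<close> in \<open>x\<close> only, and a
  basis that contains \<open>J\<close> and lies in \<open>J \<union> B\<close> can meet \<open>D\<close> only in \<open>x\<close>.
\<close>

lemma indep_insert_cocircuit:
  assumes M: "matroid M" and D: "cocircuit M D" and J: "J \<in> indeps M" "J \<inter> D = {}" and x: "x \<in> D"
  shows "insert x J \<in> indeps M"
proof -
  have sub: "D \<subseteq> ground M" using D by (simp add: cocircuit_def circuit_def)
  have hit: "B \<inter> D \<noteq> {}" if "basis M B" for B
    using that D by (auto simp: cocircuit_def circuit_def indeps_dual)
  have "D - {x} \<in> indeps (dual M)"
    using D x circuit_Diff_indep unfolding cocircuit_def by metis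
  then obtain B where B: "basis M B" "D - {x} \<subseteq> ground M - B" by (auto simp: indeps_dual)
  obtain K where K: "basis M K" "J \<subseteq> K" "K \<subseteq> J \<union> B"
    using basis_extend_within[OF M J(1) B(1)] by blast
  have "x \<in> K" using hit[OF K(1)] K(3) J(2) B(2) by blast
  then show ?thesis using K indep_mono[OF M, of K "insert x J"] by (auto simp: basis_def)
qed

lemma circuit_cocircuit_Int:
  assumes M: "matroid M" and C: "circuit M C" and D: "cocircuit M D"
  shows "C \<inter> D \<noteq> {x}"
proof
  assume x: "C \<inter> D = {x}"
  then have "insert x (C - {x}) \<in> indeps M"
    using circuit_Diff_indep[OF C] by (intro indep_insert_cocircuit[OF M D]) auto
  moreover have "insert x (C - {x}) = C" using x by blast
  ultimately show False using C by (simp add: circuit_def)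
qed

section \<open>Blocks of consecutive elements\<close>

text \<open>
  A half-open index range, so that the length is \<open>t\<close> for every \<open>t\<close> and no truncated subtraction
  occurs.
\<close>

definition block :: "'a list \<Rightarrow> nat \<Rightarrow> nat \<Rightarrow> 'a set" where
  "block \<sigma> t i = cyc_elem \<sigma> ` {i..<i + t}"

lemma cyc_interval_block: "t > 0 \<Longrightarrow> cyc_interval \<sigma> i (i + t - 1) = block \<sigma> t i"
  unfolding cyc_interval_def block_def by (rule arg_cong[of _ _ "image _"]) auto

lemma cyc_elem_add_length: "i \<ge> 1 \<Longrightarrow> cyc_elem \<sigma> (i + length \<sigma>) = cyc_elem \<sigma> i"
  unfolding cyc_elem_def by (metis Nat.add_diff_assoc2 mod_add_self2)

lemma block_add_length:
  assumes "i \<ge> 1"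
  shows "block \<sigma> t (i + length \<sigma>) = block \<sigma> t i"
proof -
  have shift: "{i + length \<sigma>..<i + length \<sigma> + t} = (\<lambda>k. k + length \<sigma>) ` {i..<i + t}"
    by (simp add: add.commute add.left_commute)
  show ?thesis
    unfolding block_def shift image_image
    by (rule image_cong) (use assms in \<open>auto simp: cyc_elem_add_length\<close>)
qed

lemma block_add_mult_length:
  "i \<ge> 1 \<Longrightarrow> block \<sigma> t (i + m * length \<sigma>) = block \<sigma> t i"
proof (induction m)
  case (Suc m)
  then show ?case
    using block_add_length[of "i + m * length \<sigma>" \<sigma> t] by (simp add: add.commute add.left_commute)
qed simp

text \<open>
  Any \<open>n\<close> consecutive indices, starting anywhere, give distinct elements; working inside such a window
  turns statements about blocks into statements about intervals of natural numbers.
\<close>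

lemma inj_on_cyc_elem:
  assumes d: "distinct \<sigma>" and i: "i \<ge> 1"
  shows "inj_on (cyc_elem \<sigma>) {i..<i + length \<sigma>}"
proof (rule linorder_inj_onI)
  fix a b assume ab: "a < b" "a \<in> {i..<i + length \<sigma>}" "b \<in> {i..<i + length \<sigma>}"
  then have pos: "length \<sigma> > 0" by auto
  show "cyc_elem \<sigma> a \<noteq> cyc_elem \<sigma> b"
  proof
    assume "cyc_elem \<sigma> a = cyc_elem \<sigma> b"
    then have "(b - 1) mod length \<sigma> = (a - 1) mod length \<sigma>"
      using d pos by (simp add: cyc_elem_def nth_eq_iff_index_eq)
    then have "length \<sigma> dvd (b - 1) - (a - 1)"
      using ab by (subst (asm) mod_eq_dvd_iff_nat) auto
    moreover have "0 < (b - 1) - (a - 1)" "(b - 1) - (a - 1) < length \<sigma>" using ab i by auto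
    ultimately show False using nat_dvd_not_less by blast
  qed
qed auto

lemma block_Int_block:
  assumes "distinct \<sigma>" "i \<ge> 1" "t \<ge> 1" "2 * t - 1 \<le> length \<sigma>"
  shows "block \<sigma> t i \<inter> block \<sigma> t (i + t - 1) = {cyc_elem \<sigma> (i + t - 1)}"
proof -
  have "block \<sigma> t i \<inter> block \<sigma> t (i + t - 1)
      = cyc_elem \<sigma> ` ({i..<i + t} \<inter> {i + t - 1..<i + t - 1 + t})"
    unfolding block_def using assms
    by (intro inj_on_image_Int[OF inj_on_cyc_elem[OF assms(1,2)], symmetric]) auto
  also have "{i..<i + t} \<inter> {i + t - 1..<i + t - 1 + t} = {i + t - 1}" using assms by auto
  finally show ?thesis by simp
qed

lemma circuit_block_not_cocircuit_block:
  assumes M: "matroid M" and s: "distinct \<sigma>" "i \<ge> 1" "t \<ge> 1" "2 * t - 1 \<le> length \<sigma>"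
  shows "circuit M (block \<sigma> t i) \<Longrightarrow> \<not> cocircuit M (block \<sigma> t (i + t - 1))"
    and "cocircuit M (block \<sigma> t i) \<Longrightarrow> \<not> circuit M (block \<sigma> t (i + t - 1))"
  using circuit_cocircuit_Int[OF M] block_Int_block[OF s] by (metis Int_commute)+

text \<open>
  The independent set is grown as \<open>{e\<^sub>i, \<dots>, e\<^bsub>i+t-2\<^esub>}\<close>, then \<open>e\<^bsub>i+t\<^esub>\<close>, then \<open>e\<^bsub>i+t+2\<^esub>\<close>. After the second stage it
  has \<open>t\<close> elements and lies in the block of length \<open>t + 2\<close>, which bounds the nullity; the third stage
  leaves the block and serves only to bound the rank.
\<close>

lemma circuit_block_elongate_trunc:
  assumes M: "matroid M" and s: "distinct \<sigma>" "i \<ge> 1" and t: "t \<ge> 2" "2 * t + 2 \<le> length \<sigma>"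
    and C: "circuit M (block \<sigma> t i)" "circuit M (block \<sigma> t (i + 2))"
    and D: "cocircuit M (block \<sigma> t (i + t))" "cocircuit M (block \<sigma> t (i + t + 2))"
  shows "t + 1 \<le> rank M" "circuit (elongate (trunc M)) (block \<sigma> (t + 2) i)"
    "card (block \<sigma> (t + 2) i) = t + 2"
proof -
  let ?e = "cyc_elem \<sigma>" and ?W = "{i..<i + length \<sigma>}"
  have inj: "inj_on ?e ?W" by (rule inj_on_cyc_elem[OF s])
  have card_e: "card (?e ` S) = card S" if "S \<subseteq> ?W" for S
    using that inj by (metis card_image inj_on_subset)
  have disj: "?e ` S \<inter> ?e ` T = {}" if "S \<subseteq> ?W" "T \<subseteq> ?W" "S \<inter> T = {}" for S T
    using that inj by (metis image_empty inj_on_image_Int)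
  define S where "S = {i..<i + (t - 1)}"
  have "S = {i..<i + t} - {i + t - 1}" using t by (auto simp: S_def)
  moreover have "?e ` ({i..<i + t} - {i + t - 1}) = ?e ` {i..<i + t} - ?e ` {i + t - 1}"
    using t by (intro inj_on_image_set_diff[OF inj]) auto
  ultimately have "?e ` S = block \<sigma> t i - {?e (i + t - 1)}"
    by (simp add: block_def)
  moreover have "?e (i + t - 1) \<in> block \<sigma> t i" using t by (auto simp: block_def)
  ultimately have S: "?e ` S \<in> indeps M" using circuit_Diff_indep[OF C(1)] by simp
  have "?e ` S \<inter> block \<sigma> t (i + t) = {}"
    unfolding block_def using t by (intro disj) (auto simp: S_def)
  then have T: "?e ` insert (i + t) S \<in> indeps M"
    using indep_insert_cocircuit[OF M D(1) S, of "?e (i + t)"] t by (auto simp: block_def)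
  have "?e ` insert (i + t) S \<inter> block \<sigma> t (i + t + 2) = {}"
    unfolding block_def using t by (intro disj) (auto simp: S_def)
  then have U: "?e ` insert (i + t + 2) (insert (i + t) S) \<in> indeps M"
    using indep_insert_cocircuit[OF M D(2) T, of "?e (i + t + 2)"] t by (auto simp: block_def)
  have "card (?e ` insert (i + t + 2) (insert (i + t) S)) = t + 1"
    using t by (subst card_e) (auto simp: S_def)
  then show rk: "t + 1 \<le> rank M" using card_indep_le_rank[OF M U] by simp
  show cb: "card (block \<sigma> (t + 2) i) = t + 2"
    unfolding block_def using t by (subst card_e) auto
  have un: "block \<sigma> (t + 2) i = block \<sigma> t i \<union> block \<sigma> t (i + 2)"
    unfolding block_def image_Un[symmetric] using t by (intro arg_cong[of _ _ "image _"]) auto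
  have "?e ` {i} \<inter> block \<sigma> t (i + 2) = {}"
    unfolding block_def using t by (intro disj) auto
  moreover have "?e i \<in> block \<sigma> t i" using t by (auto simp: block_def)
  ultimately have ne: "block \<sigma> t i \<noteq> block \<sigma> t (i + 2)" by auto
  have "?e ` insert (i + t) S \<subseteq> block \<sigma> (t + 2) i"
    unfolding block_def by (intro image_mono) (auto simp: S_def)
  then have sub: "?e ` insert (i + t) S \<subseteq> block \<sigma> t i \<union> block \<sigma> t (i + 2)"
    unfolding un .
  have cT: "card (?e ` insert (i + t) S) = t"
    using t by (subst card_e) (auto simp: S_def)
  show "circuit (elongate (trunc M)) (block \<sigma> (t + 2) i)"
    unfolding un
    by (rule circuit_elongate_trunc[OF M C ne T sub])
      (use rk cb cT in \<open>simp_all add: un[symmetric] del: add_2_eq_Suc'\<close>)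
qed

section \<open>Parity in a cyclic ordering\<close>

lemma cyclic_ordering_block:
  assumes "cyclic_ordering t M \<sigma>" "t \<ge> 1" "odd i" "i \<le> length \<sigma>"
  shows "circuit M (block \<sigma> t i)" "cocircuit M (block \<sigma> t i) \<or> cocircuit M (block \<sigma> t (i + 1))"
proof -
  have "card (ground M) = length \<sigma>"
    using assms(1) by (metis cyclic_ordering_def distinct_card)
  moreover have "i \<ge> 1" using assms(3) by (cases i) auto
  moreover have "cyc_interval \<sigma> (i + 1) (i + t) = block \<sigma> t (i + 1)"
    using cyc_interval_block[of t \<sigma> "i + 1"] assms(2) by simp
  ultimately show "circuit M (block \<sigma> t i)"
    "cocircuit M (block \<sigma> t i) \<or> cocircuit M (block \<sigma> t (i + 1))"
    using assms cyc_interval_block[of t \<sigma> i] unfolding cyclic_ordering_def Let_def by auto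
qed

text \<open>
  Suppose \<open>n\<close> is odd. Near the end of the list the parity of \<open>t\<close> decides, as in the even case, which of
  the two possible blocks is a cocircuit. The chosen index makes that cocircuit block end at
  index \<open>n + 1\<close>, that is, at \<open>e\<^sub>1\<close>, where the circuit block at \<open>1\<close> begins.
\<close>

lemma even_length_cyclic_ordering:
  assumes M: "matroid M" and s: "cyclic_ordering t M \<sigma>" and t: "t \<ge> 2" "2 * t \<le> length \<sigma>"
  shows "even (length \<sigma>)"
proof (rule ccontr)
  assume oddn: "odd (length \<sigma>)"
  let ?n = "length \<sigma>"
  have d: "distinct \<sigma>" using s by (simp add: cyclic_ordering_def)
  note blk = cyclic_ordering_block[OF s]
  note sep = circuit_block_not_cocircuit_block[OF M d]
  have one: "circuit M (block \<sigma> t (1 + ?n))"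
    using blk(1)[of 1] block_add_length[of 1 \<sigma> t] t by simp
  obtain m where m: "?n = 2 * t + m" using t(2) le_Suc_ex by blast
  have oddm: "odd m" using oddn m by simp
  show False
  proof (cases "even t")
    case True
    have "circuit M (block \<sigma> t (m + 4))" using blk(1)[of "m + 4"] oddm t m by simp
    then have "\<not> cocircuit M (block \<sigma> t (m + 4 + t - 1))"
      by (rule sep(1)[rotated -1]) (use t in auto)
    moreover have "m + 4 + t - 1 = (m + t + 2) + 1" by simp
    ultimately have "\<not> cocircuit M (block \<sigma> t ((m + t + 2) + 1))" by metis
    then have "cocircuit M (block \<sigma> t (m + t + 2))"
      using blk(2)[of "m + t + 2"] oddm True t m by simp
    moreover have "m + t + 2 + t - 1 = 1 + ?n" using m by simp
    ultimately show False using sep(2)[of "m + t + 2" t] one t by simp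
  next
    case False
    have "circuit M (block \<sigma> t (m + 2))" using blk(1)[of "m + 2"] oddm t m by simp
    moreover have "m + 2 + t - 1 = m + t + 1" using t by simp
    ultimately have "\<not> cocircuit M (block \<sigma> t (m + t + 1))"
      using sep(1)[of "m + 2" t] t by simp
    then have "cocircuit M (block \<sigma> t (m + t + 1 + 1))"
      using blk(2)[of "m + t + 1"] oddm False t m by simp
    moreover have "m + t + 1 + 1 + t - 1 = 1 + ?n" using m by simp
    ultimately show False using sep(2)[of "m + t + 1 + 1" t] one t by simp
  qed
qed

text \<open>
  With \<open>n\<close> even, parity of an index is well defined modulo \<open>n\<close>, so the hypothesis extends to all odd
  indices. If \<open>j + t\<close> is even, then a circuit block ends at index \<open>j\<close>, so the block at \<open>j\<close> is
  not a cocircuit; of the two candidates offered for a cocircuit, one has this parity.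
\<close>

lemma cyclic_ordering_all_blocks:
  assumes M: "matroid M" and s: "cyclic_ordering t M \<sigma>" and t: "t \<ge> 2" "2 * t \<le> length \<sigma>"
  shows "odd i \<Longrightarrow> circuit M (block \<sigma> t i)"
    and "k \<ge> 1 \<Longrightarrow> odd (k + t) \<Longrightarrow> cocircuit M (block \<sigma> t k)"
proof -
  let ?n = "length \<sigma>"
  have d: "distinct \<sigma>" using s by (simp add: cyclic_ordering_def)
  have evenn: "even ?n" by (rule even_length_cyclic_ordering[OF M s t])
  have npos: "?n > 0" using t by linarith
  have blk: "circuit M (block \<sigma> t i) \<and>
      (cocircuit M (block \<sigma> t i) \<or> cocircuit M (block \<sigma> t (i + 1)))" if i: "odd i" for i
  proof -
    \<comment> \<open>The representative of \<open>i\<close> in \<open>{1..n}\<close>, since subscripts start at 1.\<close>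
    define r where "r = (i - 1) mod ?n + 1"
    have i1: "i \<ge> 1" using i by (cases i) auto
    have e: "i = r + ((i - 1) div ?n) * ?n"
      using i1 mod_mult_div_eq[of "i - 1" ?n] by (simp add: r_def mult.commute)
    then have "odd r" using i evenn by (metis even_add even_mult_iff)
    moreover have "r \<le> ?n" using mod_less_divisor[OF npos, of "i - 1"] by (simp add: r_def)
    ultimately have "circuit M (block \<sigma> t r)"
      "cocircuit M (block \<sigma> t r) \<or> cocircuit M (block \<sigma> t (r + 1))"
      using cyclic_ordering_block[OF s] t(1) by simp_all
    moreover have "block \<sigma> t i = block \<sigma> t r"
      by (subst e, rule block_add_mult_length) (simp add: r_def)
    moreover have "block \<sigma> t (i + 1) = block \<sigma> t (r + 1)"
    proof -
      have "i + 1 = (r + 1) + ((i - 1) div ?n) * ?n" using e by linarith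
      then show ?thesis using block_add_mult_length[of "r + 1" \<sigma> t] by (metis le_add2)
    qed
    ultimately show ?thesis by metis
  qed
  then show "circuit M (block \<sigma> t i)" if "odd i" for i using that by blast
  have no: "\<not> cocircuit M (block \<sigma> t j)" if j: "j \<ge> 1" "even (j + t)" for j
  proof -
    \<comment> \<open>The circuit ending at \<open>j\<close> starts at \<open>j - (t - 1)\<close>; adding \<open>n\<close> keeps the index positive.\<close>
    define i where "i = j + (?n - (t - 1))"
    have le: "t - 1 \<le> ?n" using t by simp
    have "odd i"
      unfolding i_def using le evenn j(2) t(1) by (cases t) auto
    then have "circuit M (block \<sigma> t i)" using blk by blast
    then have "\<not> cocircuit M (block \<sigma> t (i + t - 1))"
      using j(1) t by (intro circuit_block_not_cocircuit_block(1)[OF M d]) (auto simp: i_def)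
    moreover have "i + t - 1 = j + ?n" using le t(1) by (simp add: i_def)
    ultimately show ?thesis using block_add_length[OF j(1), of \<sigma> t] by simp
  qed
  show "cocircuit M (block \<sigma> t k)" if k: "k \<ge> 1" "odd (k + t)" for k
  proof (cases "even t")
    case True
    then have "odd k" "\<not> cocircuit M (block \<sigma> t (k + 1))" using k no[of "k + 1"] by auto
    then show ?thesis using blk by blast
  next
    case False
    then have "even k" using k by simp
    then have o: "odd (k - 1)" "k - 1 + 1 = k" "k - 1 \<ge> 1" using k by (auto elim!: evenE)
    then have "\<not> cocircuit M (block \<sigma> t (k - 1))" using False no[of "k - 1"] by auto
    then show ?thesis using blk[OF o(1)] o(2) by simp
  qed
qed

section \<open>Truncating and then lifting a cyclic matroid\<close>

theorem mainTheorem5: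
  fixes t :: nat and M M' N :: "'a set_system" and \<sigma> :: "'a list"
  assumes "t \<ge> 2"
    and "cyclic_matroid t M"
    and "card (ground M) \<ge> 2 * (t + 2) - 2"
    and "cyclic_ordering t M \<sigma>"
    and "M' = truncation M"
    and "N = higgs_lift M'"
  shows "cyclic_matroid (t + 2) N \<and> cyclic_ordering (t + 2) N \<sigma>"
proof -
  have M: "matroid M" using assms(2) by (simp add: cyclic_matroid_def)
  have d: "distinct \<sigma>" and gr: "set \<sigma> = ground M" using assms(4) by (auto simp: cyclic_ordering_def)
  have len: "length \<sigma> = card (ground M)" using d gr by (metis distinct_card)
  have t: "t \<ge> 2" "2 * t + 2 \<le> length \<sigma>" "2 * t \<le> length \<sigma>" using assms(1,3) len by auto
  note all = cyclic_ordering_all_blocks[OF M assms(4) t(1,3)]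
  have D: "matroid (dual M)" by (rule matroid_dual[OF M])
  have circ: "t + 1 \<le> rank M" "circuit (elongate (trunc M)) (block \<sigma> (t + 2) i)"
    "card (block \<sigma> (t + 2) i) = t + 2" if "odd i" for i
  proof -
    have "i \<ge> 1" using that by (cases i) auto
    from circuit_block_elongate_trunc[OF M d this t(1,2)]
    show "t + 1 \<le> rank M" "circuit (elongate (trunc M)) (block \<sigma> (t + 2) i)"
      "card (block \<sigma> (t + 2) i) = t + 2"
      using all(1)[OF that] all(1)[of "i + 2"] all(2)[of "i + t"] all(2)[of "i + t + 2"] that t(1)
      by auto
  qed
  have cocirc: "t + 1 \<le> rank (dual M)" "circuit (elongate (trunc (dual M))) (block \<sigma> (t + 2) k)"
    "card (block \<sigma> (t + 2) k) = t + 2" if "k \<ge> 1" "odd (k + t)" for k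
    using circuit_block_elongate_trunc[OF D d that(1) t(1,2)] that
      all(1)[of "k + t"] all(1)[of "k + t + 2"] all(2)[of k] all(2)[of "k + 2"]
    by (auto simp: cocircuit_dual[OF M] cocircuit_def[symmetric])
  have "t + 1 \<le> rank (dual M)" using cocirc(1)[of "t + 1"] by simp
  then have r: "rank M > 0" "rank M < card (ground M)"
    using circ(1)[of 1] rank_dual[OF M] by auto
  have T: "matroid (trunc M)" "rank (trunc M) < card (ground (trunc M))"
    using matroid_trunc[OF M r(1)] rank_trunc[OF M r(1)] r by auto
  have N: "N = elongate (trunc M)"
    using assms(5,6) truncation_eq_trunc[OF M r(1)] higgs_lift_eq_elongate[OF T] by simp
  have cocircN: "cocircuit N (block \<sigma> (t + 2) k)" if "k \<ge> 1" "odd (k + t)" for k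
    using cocirc(2)[OF that] by (simp add: cocircuit_def N dual_elongate_trunc[OF M r])
  have "cyclic_ordering (t + 2) N \<sigma>"
    unfolding cyclic_ordering_def Let_def
  proof (intro conjI ballI impI)
    fix i assume "i \<in> {1..card (ground N)}" and i: "odd i"
    have A: "cyc_interval \<sigma> i (i + (t + 2) - 1) = block \<sigma> (t + 2) i"
      by (rule cyc_interval_block) simp
    have B: "cyc_interval \<sigma> (i + 1) (i + (t + 2)) = block \<sigma> (t + 2) (i + 1)"
      using cyc_interval_block[of "t + 2" \<sigma> "i + 1"] by simp
    have "i \<ge> 1" using i by (cases i) auto
    then show "circuit N (cyc_interval \<sigma> i (i + (t + 2) - 1)) \<and>
        card (cyc_interval \<sigma> i (i + (t + 2) - 1)) = t + 2 \<and>
        cocircuit N (cyc_interval \<sigma> (i + 1) (i + (t + 2))) \<and>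
        card (cyc_interval \<sigma> (i + 1) (i + (t + 2))) = t + 2 \<or>
        circuit N (cyc_interval \<sigma> i (i + (t + 2) - 1)) \<and>
        cocircuit N (cyc_interval \<sigma> i (i + (t + 2) - 1)) \<and>
        card (cyc_interval \<sigma> i (i + (t + 2) - 1)) = t + 2"
      unfolding A B
      using circ(2,3)[OF i] cocircN[of i] cocircN[of "i + 1"] cocirc(3)[of "i + 1"] i
      by (cases "even t") (auto simp: N)
  qed (use d gr in \<open>auto simp: N\<close>)
  moreover have "matroid N" unfolding N by (rule matroid_elongate[OF T])
  moreover have "card (ground N) \<ge> t + 2 + 1" using assms(1,3) by (simp add: N)
  ultimately show ?thesis by (auto simp: cyclic_matroid_def)
qed

end
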